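(* Let $p>2$ and assume $(a_* )$ and $(a_+)$. Any solution $u$ of the maximization problem $$\max_{u\in W^{1,\infty}(\Omega)}\int_\Omega a(x)|u|^p\,dx\quad\text{subject to}\quad\int_\Omega a(x)|u|^{p-2}u\,dx=0,\quad\|\nabla u\|_{L^\infty(\Omega)}\le1$$ satisfies $\|\nabla u\|_{L^\infty(\Omega)}=1$.
   Context: $\Omega\subset\mathbb R^N$ is a bounded convex domain, $N\ge2$, with $\partial\Omega\in C^2$; $a:\Omega\to\mathbb R$. Hypotheses: $(a_* )$: $a\in L^\infty(\Omega)$ and $\int_\Omega a(x)\,dx<0$; $(a_+)$: the set $\{x\in\Omega:a(x)>0\}$ has nonempty interior. *)

theory Defs
  imports "HOL-Analysis.Analysis" "HOL-Probability.Essential_Supremum"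
begin

primrec C_k :: "nat \<Rightarrow> ('a::euclidean_space \<Rightarrow> real) \<Rightarrow> bool" where
  "C_k 0 f \<longleftrightarrow> continuous_on UNIV f"
| "C_k (Suc k) f \<longleftrightarrow> (\<forall>x. f differentiable (at x)) \<and>
     (\<forall>v. C_k k (\<lambda>x. frechet_derivative f (at x) v))"

(* Locally, after a rotation of the axes, the set is the strict epigraph of a C^2 function of
   N - 1 variables.  The vector e is the direction of the last axis; the remaining N - 1
   coordinates of x are encoded by its projection onto the hyperplane orthogonal to e, so only
   the values of h on that hyperplane matter (any C^2 function on the hyperplane extends to a
   C^2 function on the whole space by composing with the projection). *)
definition C2_boundary :: "'a::euclidean_space set \<Rightarrow> bool" where
  "C2_boundary \<Omega> \<longleftrightarrow> (\<forall>z \<in> frontier \<Omega>. \<exists>r>0. \<exists>e h. norm e = 1 \<and> C_k 2 h \<and>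
     \<Omega> \<inter> ball z r = {x \<in> ball z r. h (x - (x \<bullet> e) *\<^sub>R e) < x \<bullet> e})"

definition test_functions :: "'a::euclidean_space set \<Rightarrow> ('a \<Rightarrow> real) set" where
  "test_functions \<Omega> = {\<phi>. (\<forall>k. C_k k \<phi>) \<and>
     compact (closure {x. \<phi> x \<noteq> 0}) \<and> closure {x. \<phi> x \<noteq> 0} \<subseteq> \<Omega>}"

(* Elements of Lebesgue and Sobolev spaces are represented by functions on the whole space;
   the notions below only depend on their restriction to the domain, up to null sets. *)
definition Linf_norm :: "'a::euclidean_space set \<Rightarrow> ('a \<Rightarrow> 'b::euclidean_space) \<Rightarrow> ereal" where
  "Linf_norm \<Omega> f = esssup (lebesgue_on \<Omega>) (\<lambda>x. ereal (norm (f x)))"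

definition Linf :: "'a::euclidean_space set \<Rightarrow> ('a \<Rightarrow> 'b::euclidean_space) set" where
  "Linf \<Omega> = {f \<in> borel_measurable (lebesgue_on \<Omega>). Linf_norm \<Omega> f < \<infinity>}"

definition is_weak_gradient ::
  "'a::euclidean_space set \<Rightarrow> ('a \<Rightarrow> real) \<Rightarrow> ('a \<Rightarrow> 'a) \<Rightarrow> bool" where
  "is_weak_gradient \<Omega> u g \<longleftrightarrow>
     (\<forall>K. compact K \<and> K \<subseteq> \<Omega> \<longrightarrow> u absolutely_integrable_on K \<and> g absolutely_integrable_on K) \<and>
     (\<forall>\<phi> \<in> test_functions \<Omega>. \<forall>i \<in> Basis.
        (LINT x|lebesgue_on \<Omega>. u x * frechet_derivative \<phi> (at x) i) =
        - (LINT x|lebesgue_on \<Omega>. (g x \<bullet> i) * \<phi> x))"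

(* A weak gradient is unique up to null sets; this picks a representative. *)
definition weak_gradient :: "'a::euclidean_space set \<Rightarrow> ('a \<Rightarrow> real) \<Rightarrow> 'a \<Rightarrow> 'a" where
  "weak_gradient \<Omega> u = (SOME g. is_weak_gradient \<Omega> u g)"

definition W1inf :: "'a::euclidean_space set \<Rightarrow> ('a \<Rightarrow> real) set" where
  "W1inf \<Omega> = {u \<in> Linf \<Omega>. \<exists>g \<in> Linf \<Omega>. is_weak_gradient \<Omega> u g}"

end

theory Submission
  imports Defs "HOL-Real_Asymp.Real_Asymp"
begin

text \<open>
  The constraint \<open>\<integral> a |u| powr (p - 2) u = 0\<close> is invariant under \<open>u \<mapsto> s u\<close>, whereas the objective
  \<open>J u = \<integral> a |u| powr p\<close> is multiplied by \<open>s powr p\<close> and the norm of the gradient by \<open>s\<close>. If a maximizer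
  had a gradient of norm less than 1, then \<open>s u\<close> would still be admissible for some \<open>s > 1\<close>, and its
  value would exceed \<open>J u\<close> as soon as \<open>J u > 0\<close>.

  So it suffices to see that the maximum is positive. Inside the interior of \<open>{a > 0}\<close> take bumps
  \<open>b\<^sub>1\<close> and \<open>b\<^sub>2\<close> of class C1 that are positive exactly on two disjoint balls. For \<open>v = b\<^sub>1 - s b\<^sub>2\<close>
  the two integrals split into a contribution of each ball; the constraint becomes
  \<open>\<integral> a b\<^sub>1 powr (p - 1) = s powr (p - 1) \<integral> a b\<^sub>2 powr (p - 1)\<close>, which some \<open>s > 0\<close> satisfies, and
  \<open>J v = \<integral> a b\<^sub>1 powr p + s powr p \<integral> a b\<^sub>2 powr p\<close> is positive
  (\<open>exists_balanced_positive_W1inf\<close>). A small multiple of \<open>v\<close> is admissible.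

  Both steps speak about the norm of the chosen representative of the weak gradient, so they rest on
  two facts: weak gradients are unique up to null sets (\<open>weak_gradient_unique\<close>), and a continuous
  classical gradient is a weak gradient (\<open>classical_gradient_is_weak_gradient\<close>). For uniqueness, the
  smooth functions \<open>\<Prod>\<^sub>i exp (- 1 / (n (x\<^sub>i - a\<^sub>i))) exp (- 1 / (n (b\<^sub>i - x\<^sub>i)))\<close>, extended by 0, converge
  boundedly to the indicator of the open box \<open>(a, b)\<close>. A function that is orthogonal to all test
  functions therefore has integral 0 over every box in the domain, and by Lebesgue differentiation it
  vanishes almost everywhere.
\<close>

section \<open>Smooth functions supported in boxes\<close>

text \<open>
  The functions \<open>exp (- 1 / t) / t ^ m\<close>, continued by 0 to \<open>t \<le> 0\<close>. The parameter \<open>m\<close> makes the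
  derivative of each of them a linear combination of two others.
\<close>

definition flat :: "nat \<Rightarrow> real \<Rightarrow> real" where
  "flat m t = (if t > 0 then exp (- inverse t) * inverse t ^ m else 0)"

lemma has_real_derivative_flat:
  "(flat m has_real_derivative flat (m + 2) t - of_nat m * flat (m + 1) t) (at t)"
proof (cases t "0 :: real" rule: linorder_cases)
  case less
  have "((\<lambda>_. 0) has_real_derivative 0) (at t)" by simp
  moreover have "flat (m + 2) t - of_nat m * flat (m + 1) t = 0"
    using less by (simp add: flat_def)
  ultimately have "((\<lambda>_. 0) has_real_derivative flat (m + 2) t - of_nat m * flat (m + 1) t) (at t)"
    by simp
  then show ?thesis
    by (rule has_field_derivative_transform_within_open[of _ _ _ "{..<0}"])
      (use less in \<open>auto simp: flat_def\<close>)
next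
  case equal
  have "((\<lambda>h. flat m h / h) \<longlongrightarrow> 0) (at_left 0)"
  proof (rule tendsto_eventually)
    show "\<forall>\<^sub>F h in at_left 0. flat m h / h = 0"
      unfolding flat_def eventually_at_filter by (auto intro!: always_eventually)
  qed
  moreover have "((\<lambda>h. flat m h / h) \<longlongrightarrow> 0) (at_right 0)"
  proof (rule Lim_transform_eventually)
    show "((\<lambda>h. exp (- inverse h) * inverse h ^ m / h) \<longlongrightarrow> 0) (at_right (0::real))"
      by real_asymp
    show "\<forall>\<^sub>F h in at_right 0. exp (- inverse h) * inverse h ^ m / h = flat m h / h"
      unfolding flat_def eventually_at_filter by (auto intro!: always_eventually)
  qed
  ultimately have "((\<lambda>h. flat m h / h) \<longlongrightarrow> 0) (at 0)"
    using filterlim_split_at by blast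
  then show ?thesis
    using equal by (simp add: has_field_derivative_iff flat_def)
next
  case greater
  have "real m * inverse t ^ (m - 1) * (inverse t * inverse t) = real m * inverse t ^ (m + 1)"
    by (cases m) auto
  moreover have "((\<lambda>t. exp (- inverse t) * inverse t ^ m) has_real_derivative
      exp (- inverse t) * (inverse t * inverse t) * inverse t ^ m -
      exp (- inverse t) * (real m * inverse t ^ (m - 1) * (inverse t * inverse t))) (at t)"
    using greater by (auto intro!: derivative_eq_intros)
  ultimately have "((\<lambda>t. exp (- inverse t) * inverse t ^ m) has_real_derivative
      exp (- inverse t) * (inverse t * inverse t) * inverse t ^ m -
      exp (- inverse t) * (real m * inverse t ^ (m + 1))) (at t)"
    by (simp only:)
  then have "((\<lambda>t. exp (- inverse t) * inverse t ^ m) has_real_derivative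
      flat (m + 2) t - of_nat m * flat (m + 1) t) (at t)"
    using greater by (simp add: flat_def mult_ac)
  then show ?thesis
    by (rule has_field_derivative_transform_within_open[of _ _ _ "{0<..}"])
      (use greater in \<open>auto simp: flat_def\<close>)
qed

lemma flat_0_bounds: "0 \<le> flat 0 t" "flat 0 t \<le> 1"
  by (auto simp: flat_def)

lemma flat_0_tendsto_1:
  assumes "s > 0"
  shows "(\<lambda>n. flat 0 (real (Suc n) * s)) \<longlonglongrightarrow> 1"
proof -
  have "(\<lambda>n. exp (- inverse (real (Suc n) * s))) \<longlonglongrightarrow> 1"
    using assms by real_asymp
  then show ?thesis using assms by (simp add: flat_def)
qed

text \<open>
  A set of functions that contains \<open>x \<mapsto> flat m (\<alpha> + w \<bullet> x)\<close> and is closed under sums, products and,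
  by the lemma that follows, directional derivatives. Closure under derivatives is what makes all of
  its members infinitely differentiable: \<open>C_k k\<close> then follows for the whole set by induction on \<open>k\<close>,
  without a chain rule or a product rule for \<open>C_k\<close>.
\<close>

inductive_set flat_algebra :: "('a::euclidean_space \<Rightarrow> real) set" where
  const: "(\<lambda>x. c) \<in> flat_algebra"
| flat: "(\<lambda>x. flat m (\<alpha> + w \<bullet> x)) \<in> flat_algebra"
| add: "f \<in> flat_algebra \<Longrightarrow> g \<in> flat_algebra \<Longrightarrow> (\<lambda>x. f x + g x) \<in> flat_algebra"
| mult: "f \<in> flat_algebra \<Longrightarrow> g \<in> flat_algebra \<Longrightarrow> (\<lambda>x. f x * g x) \<in> flat_algebra"

lemma flat_algebra_derivative:
  assumes "f \<in> flat_algebra"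
  shows "\<exists>D. (\<forall>x. (f has_derivative D x) (at x)) \<and> (\<forall>v. (\<lambda>x. D x v) \<in> flat_algebra)"
  using assms
proof induction
  case (const c)
  show ?case
    by (rule exI[of _ "\<lambda>x v. 0"]) (auto intro: flat_algebra.const)
next
  case (flat m \<alpha> w)
  let ?D = "\<lambda>x v. (flat (m + 2) (\<alpha> + w \<bullet> x) + (- of_nat m) * flat (m + 1) (\<alpha> + w \<bullet> x)) * (w \<bullet> v)"
  have "((\<lambda>x. flat m (\<alpha> + w \<bullet> x)) has_derivative ?D x) (at x)" for x
  proof -
    have "((\<lambda>x. \<alpha> + w \<bullet> x) has_derivative (\<lambda>v. w \<bullet> v)) (at x)"
      by (auto intro!: derivative_eq_intros)
    from has_derivative_compose[OF this
        has_real_derivative_flat[unfolded has_field_derivative_def, of m "\<alpha> + w \<bullet> x"]]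
    show ?thesis by simp
  qed
  moreover have "(\<lambda>x. ?D x v) \<in> flat_algebra" for v
    by (intro flat_algebra.intros)
  ultimately show ?case by (intro exI[of _ ?D]) auto
next
  case (add f g)
  then obtain D E where
    D: "\<forall>x. (f has_derivative D x) (at x)" "\<forall>v. (\<lambda>x. D x v) \<in> flat_algebra" and
    E: "\<forall>x. (g has_derivative E x) (at x)" "\<forall>v. (\<lambda>x. E x v) \<in> flat_algebra"
    by blast
  show ?case
    by (rule exI[of _ "\<lambda>x v. D x v + E x v"])
      (use D E in \<open>auto intro!: has_derivative_add flat_algebra.intros\<close>)
next
  case (mult f g)
  then obtain D E where
    D: "\<forall>x. (f has_derivative D x) (at x)" "\<forall>v. (\<lambda>x. D x v) \<in> flat_algebra" and
    E: "\<forall>x. (g has_derivative E x) (at x)" "\<forall>v. (\<lambda>x. E x v) \<in> flat_algebra"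
    by blast
  show ?case
    by (rule exI[of _ "\<lambda>x v. f x * E x v + D x v * g x"])
      (use D E mult in \<open>auto intro!: has_derivative_mult flat_algebra.intros\<close>)
qed

lemma C_k_flat_algebra: "f \<in> flat_algebra \<Longrightarrow> C_k k f"
proof (induction k arbitrary: f)
  case 0
  then obtain D where "\<And>x. (f has_derivative D x) (at x)"
    using flat_algebra_derivative by blast
  then show ?case
    by (auto intro!: continuous_at_imp_continuous_on has_derivative_continuous)
next
  case (Suc k)
  obtain D where D: "\<And>x. (f has_derivative D x) (at x)" "\<And>v. (\<lambda>x. D x v) \<in> flat_algebra"
    using flat_algebra_derivative[OF Suc.prems] by blast
  have "frechet_derivative f (at x) = D x" for x
    using frechet_derivative_at[OF D(1)] by simp
  with D Suc.IH show ?case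
    by (auto simp: differentiable_def)
qed

lemma prod_in_flat_algebra:
  "finite I \<Longrightarrow> (\<And>i. i \<in> I \<Longrightarrow> F i \<in> flat_algebra) \<Longrightarrow> (\<lambda>x. \<Prod>i\<in>I. F i x) \<in> flat_algebra"
  by (induction rule: finite_induct) (auto intro: flat_algebra.intros)

text \<open>
  Each factor is \<open>exp (- 1 / (n s))\<close> with \<open>s\<close> the distance to a face of the box. It is at most 1 and tends
  to 1 as \<open>n\<close> grows, so the sequence approximates the indicator of the open box from below.
\<close>

definition box_bump :: "'a::euclidean_space \<Rightarrow> 'a \<Rightarrow> nat \<Rightarrow> 'a \<Rightarrow> real" where
  "box_bump a b n x =
     (\<Prod>i\<in>Basis. flat 0 (real (Suc n) * ((x - a) \<bullet> i)) * flat 0 (real (Suc n) * ((b - x) \<bullet> i)))"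

lemma box_bump_in_flat_algebra: "box_bump a b n \<in> flat_algebra"
proof -
  have "(\<lambda>x. flat 0 (real (Suc n) * ((x - a) \<bullet> i)) * flat 0 (real (Suc n) * ((b - x) \<bullet> i))) \<in> flat_algebra"
    for i :: 'a
  proof -
    have "(\<lambda>x. flat 0 (real (Suc n) * ((x - a) \<bullet> i))) =
        (\<lambda>x. flat 0 (- (real (Suc n) * (a \<bullet> i)) + (real (Suc n) *\<^sub>R i) \<bullet> x))"
      and "(\<lambda>x. flat 0 (real (Suc n) * ((b - x) \<bullet> i))) =
        (\<lambda>x. flat 0 ((real (Suc n) * (b \<bullet> i)) + (- real (Suc n) *\<^sub>R i) \<bullet> x))"
      by (auto simp: algebra_simps inner_commute intro!: ext arg_cong[of _ _ "flat 0"])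
    then show ?thesis
      by (metis (no_types) flat_algebra.flat flat_algebra.mult)
  qed
  then show ?thesis
    unfolding box_bump_def[abs_def] by (intro prod_in_flat_algebra) auto
qed

lemma box_bump_bounds: "0 \<le> box_bump a b n x" "box_bump a b n x \<le> 1"
  unfolding box_bump_def
  by (auto intro!: prod_nonneg prod_le_1 mult_le_one simp: flat_0_bounds)

lemma box_bump_outside: "x \<notin> box a b \<Longrightarrow> box_bump a b n x = 0"
proof -
  assume "x \<notin> box a b"
  then obtain i where i: "i \<in> Basis" "(x - a) \<bullet> i \<le> 0 \<or> (b - x) \<bullet> i \<le> 0"
    by (auto simp: mem_box inner_diff_left not_less)
  have "flat 0 (real (Suc n) * s) = 0" if "s \<le> 0" for s
    using that by (simp add: flat_def zero_less_mult_iff)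
  with i show ?thesis
    unfolding box_bump_def by (intro prod_zero) (auto simp del: of_nat_Suc)
qed

lemma box_bump_tendsto: "(\<lambda>n. box_bump a b n x) \<longlonglongrightarrow> indicator (box a b) x"
proof (cases "x \<in> box a b")
  case True
  have "(\<lambda>n. box_bump a b n x) \<longlonglongrightarrow> (\<Prod>i\<in>(Basis :: 'a set). 1 * 1)"
    unfolding box_bump_def
    by (intro tendsto_prod tendsto_mult flat_0_tendsto_1)
      (use True in \<open>auto simp: mem_box inner_diff_left\<close>)
  then show ?thesis using True by simp
qed (simp add: box_bump_outside)

lemma box_bump_test_function:
  assumes "cbox a b \<subseteq> \<Omega>"
  shows "box_bump a b n \<in> test_functions \<Omega>"
proof -
  have "{x. box_bump a b n x \<noteq> 0} \<subseteq> box a b"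
    using box_bump_outside by blast
  then have "closure {x. box_bump a b n x \<noteq> 0} \<subseteq> cbox a b"
    by (meson box_subset_cbox closed_cbox closure_minimal order_trans)
  moreover from this have "compact (closure {x. box_bump a b n x \<noteq> 0})"
    by (meson bounded_cbox bounded_subset closed_closure compact_eq_bounded_closed)
  ultimately show ?thesis
    using assms by (auto simp: test_functions_def C_k_flat_algebra box_bump_in_flat_algebra)
qed

section \<open>The fundamental lemma of the calculus of variations\<close>

lemma integrable_mult_compact_support:
  fixes f \<phi> :: "'a::euclidean_space \<Rightarrow> real"
  assumes "open \<Omega>" "compact K" "K \<subseteq> \<Omega>" "f absolutely_integrable_on K"
    and "continuous_on UNIV \<phi>" "\<And>x. x \<notin> K \<Longrightarrow> \<phi> x = 0"
  shows "integrable (lebesgue_on \<Omega>) (\<lambda>x. f x * \<phi> x)"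
proof -
  obtain B where B: "\<And>x. x \<in> K \<Longrightarrow> norm (\<phi> x) \<le> B"
    using compact_imp_bounded[OF compact_continuous_image[OF continuous_on_subset[OF assms(5)] assms(2)]]
    by (auto simp: bounded_iff)
  have \<phi>[measurable]: "\<phi> \<in> borel_measurable lebesgue"
    using borel_measurable_continuous_onI[OF assms(5)] by (simp add: measurable_completion)
  have f: "integrable lebesgue (\<lambda>x. indicator K x *\<^sub>R f x)"
    using assms(4) unfolding set_integrable_def .
  have "integrable lebesgue (\<lambda>x. (indicator K x *\<^sub>R f x) * \<phi> x)"
  proof (rule Bochner_Integration.integrable_bound)
    show "integrable lebesgue (\<lambda>x. B * (indicator K x *\<^sub>R f x))"
      using f by simp
    show "(\<lambda>x. (indicator K x *\<^sub>R f x) * \<phi> x) \<in> borel_measurable lebesgue"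
      using borel_measurable_integrable[OF f] \<phi> by measurable
    have "\<bar>f x\<bar> * \<bar>\<phi> x\<bar> \<le> \<bar>B\<bar> * \<bar>f x\<bar>" if "x \<in> K" for x
      using mult_right_mono[of "\<bar>\<phi> x\<bar>" "\<bar>B\<bar>" "\<bar>f x\<bar>"] B[OF that] by (simp add: mult.commute)
    then show "AE x in lebesgue. norm ((indicator K x *\<^sub>R f x) * \<phi> x) \<le> norm (B * (indicator K x *\<^sub>R f x))"
      by (intro AE_I2) (auto simp: indicator_def abs_mult)
  qed
  also have "(\<lambda>x. (indicator K x *\<^sub>R f x) * \<phi> x) = (\<lambda>x. indicator \<Omega> x *\<^sub>R (f x * \<phi> x))"
  proof
    show "(indicator K x *\<^sub>R f x) * \<phi> x = indicator \<Omega> x *\<^sub>R (f x * \<phi> x)" for x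
      using assms(3,6) by (cases "x \<in> K") auto
  qed
  finally show ?thesis
    using assms(1) by (simp add: integrable_restrict_space)
qed

text \<open>Dominated convergence along the test functions \<open>box_bump a b n\<close>.\<close>

lemma test_function_integral_box_eq_0:
  fixes f :: "'a::euclidean_space \<Rightarrow> real"
  assumes "open \<Omega>" "cbox a b \<subseteq> \<Omega>" "f absolutely_integrable_on cbox a b"
    and "\<And>\<phi>. \<phi> \<in> test_functions \<Omega> \<Longrightarrow> (LINT x|lebesgue_on \<Omega>. f x * \<phi> x) = 0"
  shows "integral (cbox a b) f = 0"
proof -
  have f: "integrable lebesgue (\<lambda>x. indicator (cbox a b) x *\<^sub>R f x)"
    using assms(3) unfolding set_integrable_def .
  have eq: "indicator \<Omega> x *\<^sub>R (f x * box_bump a b n x) =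
      (indicator (cbox a b) x *\<^sub>R f x) * box_bump a b n x" for n x
    using assms(2) box_bump_outside[of x a b n] box_subset_cbox[of a b]
    by (auto simp: indicator_def)
  have bump_meas: "box_bump a b n \<in> borel_measurable lebesgue" for n
    using C_k_flat_algebra[OF box_bump_in_flat_algebra, of 0 a b n]
    by (simp add: measurable_completion borel_measurable_continuous_onI)
  have f_meas: "(\<lambda>x. indicator (cbox a b) x *\<^sub>R f x) \<in> borel_measurable lebesgue"
    by (rule borel_measurable_integrable[OF f])
  have "(\<lambda>n. LINT x|lebesgue. (indicator (cbox a b) x *\<^sub>R f x) * box_bump a b n x)
      \<longlonglongrightarrow> (LINT x|lebesgue. (indicator (cbox a b) x *\<^sub>R f x) * indicator (box a b) x)"
  proof (rule integral_dominated_convergence)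
    show "integrable lebesgue (\<lambda>x. norm (indicator (cbox a b) x *\<^sub>R f x))"
      using f by (rule integrable_norm)
    show "AE x in lebesgue. (\<lambda>n. (indicator (cbox a b) x *\<^sub>R f x) * box_bump a b n x)
        \<longlonglongrightarrow> (indicator (cbox a b) x *\<^sub>R f x) * indicator (box a b) x"
      by (intro AE_I2 tendsto_mult tendsto_const box_bump_tendsto)
    show "AE x in lebesgue. norm ((indicator (cbox a b) x *\<^sub>R f x) * box_bump a b n x)
        \<le> norm (indicator (cbox a b) x *\<^sub>R f x)" for n
      using box_bump_bounds[of a b n] by (intro AE_I2) (auto simp: abs_mult intro: mult_left_le)
  qed (intro borel_measurable_times f_meas bump_meas borel_measurable_indicator; simp)+
  moreover have "(LINT x|lebesgue. (indicator (cbox a b) x *\<^sub>R f x) * box_bump a b n x) = 0" for n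
  proof -
    have "(LINT x|lebesgue_on \<Omega>. f x * box_bump a b n x) =
        (LINT x|lebesgue. indicator \<Omega> x *\<^sub>R (f x * box_bump a b n x))"
      using assms(1) by (intro integral_restrict_space) simp
    then show ?thesis
      using assms(4)[OF box_bump_test_function[OF assms(2), of n]] by (simp only: eq)
  qed
  ultimately have "(LINT x|lebesgue. (indicator (cbox a b) x *\<^sub>R f x) * indicator (box a b) x) = 0"
    by (simp add: LIMSEQ_const_iff)
  moreover have "(\<lambda>x. (indicator (cbox a b) x *\<^sub>R f x) * indicator (box a b) x) =
      (\<lambda>x. indicator (box a b) x *\<^sub>R f x)"
  proof
    show "(indicator (cbox a b) x *\<^sub>R f x) * indicator (box a b) x =
      indicator (box a b) x *\<^sub>R f x" for x
      using box_subset_cbox[of a b] by (cases "x \<in> box a b") auto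
  qed
  ultimately have "(LINT x:box a b|lebesgue. f x) = 0"
    by (simp add: set_lebesgue_integral_def)
  moreover have "f absolutely_integrable_on box a b"
    using set_integrable_subset[OF assms(3) _ box_subset_cbox] by simp
  ultimately have "integral (box a b) f = 0"
    using set_lebesgue_integral_eq_integral(2) by metis
  then show ?thesis by (simp add: integral_open_interval)
qed

text \<open>
  By Lebesgue differentiation, almost every value of \<open>f\<close> is the limit of the averages of \<open>f\<close> over small
  cubes \<open>cbox x (x + h *\<^sub>R One)\<close>, and these averages are 0 once the cube lies in the box.
\<close>

lemma negligible_nonzero_if_box_integrals_0:
  fixes f :: "'a::euclidean_space \<Rightarrow> real"
  assumes "f integrable_on cbox a b"
    and zero: "\<And>c d. cbox c d \<subseteq> cbox a b \<Longrightarrow> integral (cbox c d) f = 0"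
  shows "negligible {x \<in> cbox a b. f x \<noteq> 0}"
proof -
  let ?F = "\<lambda>x. if x \<in> cbox a b then f x else 0"
  have "?F integrable_on UNIV"
    using assms(1) by (simp add: integrable_restrict_UNIV)
  then have "?F integrable_on cbox c d" for c d
    by (rule integrable_on_subcbox) simp
  then obtain N where N: "negligible N"
    and lim: "\<And>x e. \<lbrakk>x \<notin> N; 0 < e\<rbrakk> \<Longrightarrow> \<exists>d>0. \<forall>h. 0 < h \<and> h < d \<longrightarrow>
      norm (integral (cbox x (x + h *\<^sub>R One)) ?F /\<^sub>R h ^ DIM('a) - ?F x) < e"
    using integrable_ccontinuous_explicit[of ?F] by blast
  have "f x = 0" if x: "x \<in> box a b" "x \<notin> N" for x
  proof (rule ccontr)
    assume "f x \<noteq> 0"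
    then obtain d where d: "d > 0" "\<And>h. 0 < h \<Longrightarrow> h < d \<Longrightarrow>
        norm (integral (cbox x (x + h *\<^sub>R One)) ?F /\<^sub>R h ^ DIM('a) - ?F x) < \<bar>f x\<bar>"
      using lim[OF x(2), of "\<bar>f x\<bar>"] by auto
    (* A cube at x whose side is at most r stays in the box. *)
    define r where "r = Min ((\<lambda>i. (b - x) \<bullet> i) ` Basis)"
    have "r > 0" using x(1) by (auto simp: r_def mem_box inner_diff_left)
    define h where "h = min d r / 2"
    have h: "0 < h" "h < d" "h \<le> r" using d(1) \<open>r > 0\<close> by (auto simp: h_def min_def)
    have "h \<le> (b - x) \<bullet> i" if "i \<in> Basis" for i
      using h(3) that by (auto simp: r_def intro: order_trans)
    then have sub: "cbox x (x + h *\<^sub>R One) \<subseteq> cbox a b"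
      using x(1) by (subst subset_box) (auto simp: mem_box inner_diff_left inner_add_left less_imp_le algebra_simps)
    have "integral (cbox x (x + h *\<^sub>R One)) ?F = integral (cbox x (x + h *\<^sub>R One)) f"
      by (rule integral_cong) (use sub in auto)
    also have "\<dots> = 0" using zero[OF sub] .
    finally show False
      using d(2)[OF h(1,2)] x(1) box_subset_cbox[of a b] by auto
  qed
  then have "{x \<in> cbox a b. f x \<noteq> 0} \<subseteq> (cbox a b - box a b) \<union> N" by blast
  moreover have "negligible ((cbox a b - box a b) \<union> N)"
    using N negligible_frontier_interval by (rule negligible_Un[rotated])
  ultimately show ?thesis by (rule negligible_subset[rotated])
qed

lemma AE_eq_0_if_test_integrals_0:
  fixes f :: "'a::euclidean_space \<Rightarrow> real"
  assumes "open \<Omega>"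
    and int: "\<And>K. compact K \<Longrightarrow> K \<subseteq> \<Omega> \<Longrightarrow> f absolutely_integrable_on K"
    and zero: "\<And>\<phi>. \<phi> \<in> test_functions \<Omega> \<Longrightarrow> (LINT x|lebesgue_on \<Omega>. f x * \<phi> x) = 0"
  shows "AE x in lebesgue_on \<Omega>. f x = 0"
proof -
  obtain \<D> where \<D>: "countable \<D>" "\<D> \<subseteq> Pow \<Omega>" "\<And>X. X \<in> \<D> \<Longrightarrow> \<exists>a b. X = cbox a b" "\<Union>\<D> = \<Omega>"
    using open_countable_Union_open_cbox[OF assms(1)] by metis
  have "negligible {x \<in> X. f x \<noteq> 0}" if XD: "X \<in> \<D>" for X
  proof -
    obtain a b where X: "X = cbox a b" using \<D>(3)[OF XD] by blast
    have "cbox a b \<subseteq> \<Omega>" using \<D>(2) XD X by blast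
    then have "f absolutely_integrable_on cbox c d" "integral (cbox c d) f = 0"
      if "cbox c d \<subseteq> cbox a b" for c d
      using int zero that test_function_integral_box_eq_0[OF assms(1), of c d f]
      by (meson compact_cbox order_trans)+
    then show ?thesis
      unfolding X
      by (intro negligible_nonzero_if_box_integrals_0 set_lebesgue_integral_eq_integral(1)) auto
  qed
  then have "negligible (\<Union>X\<in>\<D>. {x \<in> X. f x \<noteq> 0})"
    using \<D>(1) by (intro negligible_countable_Union) auto
  also have "(\<Union>X\<in>\<D>. {x \<in> X. f x \<noteq> 0}) = {x \<in> \<Omega>. f x \<noteq> 0}"
    using \<D>(4) by blast
  finally have "{x \<in> \<Omega>. f x \<noteq> 0} \<in> null_sets lebesgue"
    by (simp add: negligible_iff_null_sets)
  then have "AE x in lebesgue. x \<in> \<Omega> \<longrightarrow> f x = 0"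
    by (rule AE_I') auto
  then show ?thesis
    using assms(1) by (simp add: AE_restrict_space_iff)
qed

section \<open>Classical gradients are weak gradients\<close>

lemma lebesgue_integral_translation:
  fixes w :: "'a::euclidean_space \<Rightarrow> real"
  assumes "w \<in> borel_measurable borel"
  shows "(LINT x|lebesgue. w (x + c)) = (LINT x|lebesgue. w x)"
proof -
  have "(LINT x|lborel. w x) = (LINT x|distr lborel borel ((+) c). w x)"
    by (simp add: lborel_distr_plus)
  also have "\<dots> = (LINT x|lborel. w (c + x))"
    using assms by (intro integral_distr) auto
  finally show ?thesis
    using assms by (simp add: integral_completion add.commute)
qed

lemma lebesgue_integral_supported_in_cbox:
  fixes w :: "'a::euclidean_space \<Rightarrow> real"
  assumes "continuous_on UNIV w" "\<And>x. x \<notin> cbox a b \<Longrightarrow> w x = 0"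
  shows "(LINT x|lebesgue. w x) = integral (cbox a b) w"
proof -
  have "w absolutely_integrable_on cbox a b"
    using assms(1) by (auto intro: absolutely_integrable_continuous continuous_on_subset)
  then have "(LINT x:cbox a b|lebesgue. w x) = integral (cbox a b) w"
    by (rule set_lebesgue_integral_eq_integral)
  moreover have "indicator (cbox a b) x *\<^sub>R w x = w x" for x
    using assms(2) by (cases "x \<in> cbox a b") auto
  ultimately show ?thesis
    unfolding set_lebesgue_integral_def by (simp only:)
qed

text \<open>
  The integral of \<open>x \<mapsto> w (x + t i)\<close> does not depend on \<open>t\<close> because Lebesgue measure is invariant under
  translations. Differentiating under the integral sign at \<open>t = 0\<close> gives the claim.
\<close>

lemma integral_directional_derivative_eq_0:
  fixes w w' :: "'a::euclidean_space \<Rightarrow> real"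
  assumes K: "bounded K" "\<And>x. x \<notin> K \<Longrightarrow> w x = 0" "\<And>x. x \<notin> K \<Longrightarrow> w' x = 0"
    and cont: "continuous_on UNIV w" "continuous_on UNIV w'"
    and der: "\<And>x. ((\<lambda>t. w (x + t *\<^sub>R i)) has_real_derivative w' x) (at 0)"
  shows "(LINT x|lebesgue. w' x) = 0"
proof -
  obtain R where R: "\<And>x. x \<in> K \<Longrightarrow> norm x \<le> R"
    using K(1) by (auto simp: bounded_iff)
  obtain a :: 'a where a: "cball 0 (R + norm i) \<subseteq> cbox (- a) a"
    using bounded_subset_cbox_symmetric bounded_cball by blast
  (* The box contains every translate of K by t i with |t| \<le> 1. *)
  have out: "x + t *\<^sub>R i \<notin> K" if "x \<notin> cbox (- a) a" "t \<in> {-1..1}" for x t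
  proof
    assume "x + t *\<^sub>R i \<in> K"
    then have "norm x \<le> R + norm (t *\<^sub>R i)"
      using R norm_triangle_ineq4[of "x + t *\<^sub>R i" "t *\<^sub>R i"] by fastforce
    also have "\<dots> \<le> R + norm i"
      using that(2) by (auto intro: mult_left_le_one_le)
    finally show False using a that(1) by auto
  qed
  have w_shift: "integral (cbox (- a) a) (\<lambda>x. w (x + t *\<^sub>R i)) = (LINT x|lebesgue. w x)"
    if "t \<in> {-1..1}" for t
  proof -
    have "continuous_on UNIV (\<lambda>x. w (x + t *\<^sub>R i))"
      by (intro continuous_on_compose2[OF cont(1)] continuous_intros) auto
    then have "(LINT x|lebesgue. w (x + t *\<^sub>R i)) = integral (cbox (- a) a) (\<lambda>x. w (x + t *\<^sub>R i))"
      using out[OF _ that] K(2) by (intro lebesgue_integral_supported_in_cbox) auto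
    then show ?thesis
      using lebesgue_integral_translation borel_measurable_continuous_onI[OF cont(1)] by metis
  qed
  have "((\<lambda>t. integral (cbox (- a) a) (\<lambda>x. w (x + t *\<^sub>R i))) has_real_derivative
      integral (cbox (- a) a) (\<lambda>x. w' (x + 0 *\<^sub>R i))) (at 0 within {-1..1})"
  proof (rule leibniz_rule_field_derivative)
    fix t x
    have "((\<lambda>s. w ((x + t *\<^sub>R i) + s *\<^sub>R i)) has_real_derivative w' (x + t *\<^sub>R i)) (at 0)"
      by (rule der)
    then have "((\<lambda>s. w (x + s *\<^sub>R i)) has_real_derivative w' (x + t *\<^sub>R i)) (at (0 + t))"
      by (subst DERIV_shift) (simp add: algebra_simps)
    then show "((\<lambda>s. w (x + s *\<^sub>R i)) has_real_derivative w' (x + t *\<^sub>R i)) (at t within {-1..1})"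
      by (auto intro: has_field_derivative_at_within)
  next
    show "(\<lambda>x. w (x + t *\<^sub>R i)) integrable_on cbox (- a) a" for t
      by (intro integrable_continuous continuous_on_compose2[OF cont(1)] continuous_intros) auto
    show "continuous_on ({- 1..1} \<times> cbox (- a) a) (\<lambda>(t, x). w' (x + t *\<^sub>R i))"
      unfolding split_beta
      by (intro continuous_on_compose2[OF cont(2)] continuous_intros) auto
  qed auto
  then have "((\<lambda>t. integral (cbox (- a) a) (\<lambda>x. w (x + t *\<^sub>R i))) has_real_derivative
      integral (cbox (- a) a) w') (at 0 within {-1..1})"
    by simp
  then have "((\<lambda>t. LINT x|lebesgue. w x) has_real_derivative integral (cbox (- a) a) w')
      (at 0 within {-1..1})"
    by (rule has_field_derivative_transform_within[OF _ zero_less_one]) (auto simp: w_shift)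
  moreover have "at (0::real) within {-1..1} = at 0"
    by (rule at_within_interior) (simp add: interior_atLeastAtMost_real)
  ultimately have "integral (cbox (- a) a) w' = 0"
    using DERIV_unique DERIV_const by metis
  moreover have "(LINT x|lebesgue. w' x) = integral (cbox (- a) a) w'"
    using out[of _ 0] K(3) by (intro lebesgue_integral_supported_in_cbox cont) auto
  ultimately show ?thesis by simp
qed

lemma test_function_derivative:
  assumes "\<phi> \<in> test_functions \<Omega>"
  shows "continuous_on UNIV \<phi>"
    and "(\<phi> has_derivative frechet_derivative \<phi> (at x)) (at x)"
    and "continuous_on UNIV (\<lambda>x. frechet_derivative \<phi> (at x) v)"
    and "x \<notin> closure {x. \<phi> x \<noteq> 0} \<Longrightarrow> frechet_derivative \<phi> (at x) v = 0"
proof -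
  have C: "C_k k \<phi>" for k
    using assms by (auto simp: test_functions_def)
  show "continuous_on UNIV \<phi>"
    using C[of 0] by simp
  show "(\<phi> has_derivative frechet_derivative \<phi> (at x)) (at x)"
    using C[of 1] frechet_derivative_works by auto
  show "continuous_on UNIV (\<lambda>x. frechet_derivative \<phi> (at x) v)"
    using C[of 1] by simp
  assume x: "x \<notin> closure {x. \<phi> x \<noteq> 0}"
  have "((\<lambda>_. 0) has_derivative (\<lambda>_. 0)) (at x)" by simp
  then have "(\<phi> has_derivative (\<lambda>_. 0)) (at x)"
    by (rule has_derivative_transform_within_open[of _ _ _ _ "- closure {x. \<phi> x \<noteq> 0}"])
      (use x closure_subset[of "{x. \<phi> x \<noteq> 0}"] in auto)
  from frechet_derivative_at[OF this] show "frechet_derivative \<phi> (at x) v = 0"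
    by metis
qed

lemma absolutely_integrable_on_compact_continuous:
  fixes f :: "'a::euclidean_space \<Rightarrow> 'b::euclidean_space"
  assumes "compact K" "continuous_on UNIV f"
  shows "f absolutely_integrable_on K"
proof -
  obtain a where "K \<subseteq> cbox (- a) a"
    using bounded_subset_cbox_symmetric compact_imp_bounded \<open>compact K\<close> by blast
  moreover have "f absolutely_integrable_on cbox (- a) a"
    using assms(2) by (auto intro: absolutely_integrable_continuous continuous_on_subset)
  ultimately show ?thesis
    using set_integrable_subset[of lebesgue "cbox (- a) a" f K] assms(1)
    by (simp add: lmeasurable_compact fmeasurableD)
qed

text \<open>Integration by parts: the product of \<open>v\<close> and a test function has compact support, so
  its directional derivatives have integral 0.\<close>

lemma classical_gradient_is_weak_gradient:
  fixes v :: "'a::euclidean_space \<Rightarrow> real"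
  assumes "open \<Omega>" and der: "\<And>x. (v has_derivative (\<lambda>h. g x \<bullet> h)) (at x)"
    and g: "continuous_on UNIV g"
  shows "is_weak_gradient \<Omega> v g"
proof -
  have v: "continuous_on UNIV v"
    using der by (auto intro!: continuous_at_imp_continuous_on has_derivative_continuous)
  have "(LINT x|lebesgue_on \<Omega>. v x * frechet_derivative \<phi> (at x) i) =
      - (LINT x|lebesgue_on \<Omega>. (g x \<bullet> i) * \<phi> x)"
    if \<phi>: "\<phi> \<in> test_functions \<Omega>" and "i \<in> Basis" for \<phi> i
  proof -
    define K where "K = closure {x. \<phi> x \<noteq> 0}"
    have K: "compact K" "K \<subseteq> \<Omega>" using \<phi> by (auto simp: test_functions_def K_def)
    let ?d = "\<lambda>x. frechet_derivative \<phi> (at x) i"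
    let ?w' = "\<lambda>x. v x * ?d x + (g x \<bullet> i) * \<phi> x"
    note D = test_function_derivative[OF \<phi>]
    have 0: "\<phi> x = 0" "?d x = 0" if "x \<notin> K" for x
      using that D(4) closure_subset[of "{x. \<phi> x \<noteq> 0}"] by (auto simp: K_def)
    have gi: "continuous_on UNIV (\<lambda>x. g x \<bullet> i)"
      using g by (intro continuous_intros)
    have I: "integrable (lebesgue_on \<Omega>) (\<lambda>x. v x * ?d x)"
      "integrable (lebesgue_on \<Omega>) (\<lambda>x. (g x \<bullet> i) * \<phi> x)"
      using K 0 v gi D assms(1) absolutely_integrable_on_compact_continuous[OF K(1)]
      by (auto intro!: integrable_mult_compact_support[where K = K])
    have "(LINT x|lebesgue. ?w' x) = 0"
    proof (rule integral_directional_derivative_eq_0[where K = K])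
      show "bounded K" using K(1) by (rule compact_imp_bounded)
      show "((\<lambda>t. v (x + t *\<^sub>R i) * \<phi> (x + t *\<^sub>R i)) has_real_derivative ?w' x) (at 0)" for x
      proof -
        have line: "((\<lambda>t. x + t *\<^sub>R i) has_derivative (\<lambda>t. t *\<^sub>R i)) (at 0)"
          by (auto intro!: derivative_eq_intros)
        have "((\<lambda>t. v (x + t *\<^sub>R i)) has_derivative (\<lambda>t. g x \<bullet> (t *\<^sub>R i))) (at 0)"
          using has_derivative_compose[OF line, of v "\<lambda>h. g x \<bullet> h"] der[of x] by simp
        moreover have "((\<lambda>t. \<phi> (x + t *\<^sub>R i)) has_derivative (\<lambda>t. frechet_derivative \<phi> (at x) (t *\<^sub>R i))) (at 0)"
          using has_derivative_compose[OF line, of \<phi> "frechet_derivative \<phi> (at x)"] D(2)[of x] by simp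
        ultimately have "((\<lambda>t. v (x + t *\<^sub>R i) * \<phi> (x + t *\<^sub>R i)) has_derivative
            (\<lambda>t. v x * frechet_derivative \<phi> (at x) (t *\<^sub>R i) + (g x \<bullet> (t *\<^sub>R i)) * \<phi> x)) (at 0)"
          using has_derivative_mult by fastforce
        moreover have "frechet_derivative \<phi> (at x) (t *\<^sub>R i) = t * ?d x" for t
          using linear_cmul[OF has_derivative_linear[OF D(2)[of x]]] by simp
        ultimately show ?thesis
          unfolding has_field_derivative_def
          by (elim has_derivative_eq_rhs) (simp add: fun_eq_iff algebra_simps)
      qed
    qed (use 0 v gi D in \<open>auto intro!: continuous_intros\<close>)
    moreover have "indicator \<Omega> x *\<^sub>R ?w' x = ?w' x" for x
      using 0[of x] K(2) by (cases "x \<in> K") auto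
    moreover have "(LINT x|lebesgue_on \<Omega>. ?w' x) = (LINT x|lebesgue. indicator \<Omega> x *\<^sub>R ?w' x)"
      using assms(1) by (intro integral_restrict_space) simp
    ultimately have "(LINT x|lebesgue_on \<Omega>. ?w' x) = 0"
      by (simp only:)
    then show ?thesis
      using Bochner_Integration.integral_add[OF I] by simp
  qed
  then show ?thesis
    by (auto intro!: absolutely_integrable_on_compact_continuous v g simp add: is_weak_gradient_def)
qed

lemma continuous_in_Linf:
  fixes f :: "'a::euclidean_space \<Rightarrow> 'b::euclidean_space"
  assumes "open \<Omega>" "bounded \<Omega>" and f: "continuous_on UNIV f"
  shows "f \<in> Linf \<Omega>"
proof -
  have "compact (f ` closure \<Omega>)"
    using assms(2) f by (intro compact_continuous_image) (auto intro: continuous_on_subset)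
  then obtain B where "\<And>x. x \<in> closure \<Omega> \<Longrightarrow> norm (f x) \<le> B"
    using compact_imp_bounded[of "f ` closure \<Omega>"] by (auto simp: bounded_iff)
  then have B: "norm (f x) \<le> B" if "x \<in> \<Omega>" for x
    using that closure_subset by blast
  have m: "f \<in> borel_measurable (lebesgue_on \<Omega>)"
    using continuous_imp_measurable_on_sets_lebesgue[OF continuous_on_subset[OF f]] assms(1) by simp
  have "Linf_norm \<Omega> f \<le> ereal B"
    unfolding Linf_norm_def using m B assms(1) by (intro esssup_I AE_I2) auto
  then have "Linf_norm \<Omega> f < \<infinity>"
    by (rule le_less_trans) simp
  with m show ?thesis by (simp add: Linf_def)
qed

lemma C1_in_W1inf:
  fixes v :: "'a::euclidean_space \<Rightarrow> real"
  assumes "open \<Omega>" "bounded \<Omega>" and der: "\<And>x. (v has_derivative (\<lambda>h. g x \<bullet> h)) (at x)"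
    and g: "continuous_on UNIV g"
  shows "v \<in> W1inf \<Omega>"
proof -
  have "continuous_on UNIV v"
    using der by (auto intro!: continuous_at_imp_continuous_on has_derivative_continuous)
  then show ?thesis
    unfolding W1inf_def using classical_gradient_is_weak_gradient[OF assms(1) der g] g
    by (auto intro!: continuous_in_Linf[OF assms(1,2)])
qed

section \<open>Uniqueness and scaling of weak gradients\<close>

text \<open>
  Each component of the difference of two weak gradients is orthogonal to all test functions.
\<close>

lemma weak_gradient_unique:
  assumes "open \<Omega>" and g: "is_weak_gradient \<Omega> u g" "is_weak_gradient \<Omega> u g'"
  shows "AE x in lebesgue_on \<Omega>. g x = g' x"
proof -
  have "AE x in lebesgue_on \<Omega>. (g x - g' x) \<bullet> i = 0" if i: "i \<in> Basis" for i
  proof (rule AE_eq_0_if_test_integrals_0[OF assms(1)])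
    fix K assume "compact K" "K \<subseteq> \<Omega>"
    then have "(\<lambda>x. g x - g' x) absolutely_integrable_on K"
      using g by (auto simp: is_weak_gradient_def intro: set_integral_diff)
    from absolutely_integrable_linear[OF this bounded_linear_inner_left[of i]]
    show "(\<lambda>x. (g x - g' x) \<bullet> i) absolutely_integrable_on K"
      by (simp add: o_def)
  next
    fix \<phi> assume \<phi>: "\<phi> \<in> test_functions \<Omega>"
    define K where "K = closure {x. \<phi> x \<noteq> 0}"
    have K: "compact K" "K \<subseteq> \<Omega>" using \<phi> by (auto simp: test_functions_def K_def)
    have I: "integrable (lebesgue_on \<Omega>) (\<lambda>x. (h x \<bullet> i) * \<phi> x)"
      if "is_weak_gradient \<Omega> u h" for h
    proof (rule integrable_mult_compact_support[OF assms(1) K])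
      have "h absolutely_integrable_on K"
        using that K by (auto simp: is_weak_gradient_def)
      from absolutely_integrable_linear[OF this bounded_linear_inner_left[of i]]
      show "(\<lambda>x. h x \<bullet> i) absolutely_integrable_on K"
        by (simp add: o_def)
      show "\<phi> x = 0" if "x \<notin> K" for x
        using that closure_subset[of "{x. \<phi> x \<noteq> 0}"] by (auto simp: K_def)
    qed (rule test_function_derivative[OF \<phi>])
    have "(LINT x|lebesgue_on \<Omega>. (g x \<bullet> i) * \<phi> x) = (LINT x|lebesgue_on \<Omega>. (g' x \<bullet> i) * \<phi> x)"
      using g \<phi> i by (force simp: is_weak_gradient_def)
    then show "(LINT x|lebesgue_on \<Omega>. ((g x - g' x) \<bullet> i) * \<phi> x) = 0"
      using Bochner_Integration.integral_diff[OF I[OF g(1)] I[OF g(2)]]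
      by (simp add: inner_diff_left left_diff_distrib)
  qed
  then have "AE x in lebesgue_on \<Omega>. \<forall>i\<in>Basis. (g x - g' x) \<bullet> i = 0"
    by (intro AE_finite_allI) auto
  then show ?thesis
    by eventually_elim (metis eq_iff_diff_eq_0 euclidean_all_zero_iff)
qed

text \<open>
  A weak gradient is required only to be integrable on compact sets, while the essential supremum of a
  function that is not measurable is infinite. Completeness of Lebesgue measure gives measurability of
  the chosen representative from that of any other weak gradient.
\<close>

lemma borel_measurable_lebesgue_on_AE_cong:
  fixes f g :: "'a::euclidean_space \<Rightarrow> 'b::euclidean_space"
  assumes "S \<in> sets lebesgue" "f \<in> borel_measurable (lebesgue_on S)"
    and "AE x in lebesgue_on S. f x = g x"
  shows "g \<in> borel_measurable (lebesgue_on S)"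
proof (rule borel_measurable_if_D, rule measurableI)
  let ?F = "\<lambda>x. if x \<in> S then f x else 0" and ?G = "\<lambda>x. if x \<in> S then g x else 0"
  fix A :: "'b set" assume A: "A \<in> sets borel"
  have "?F \<in> borel_measurable lebesgue"
    using assms(1,2) borel_measurable_if_I by blast
  from measurable_sets[OF this A] have F: "?F -` A \<in> sets lebesgue"
    by simp
  have "AE x in lebesgue. x \<in> S \<longrightarrow> f x = g x"
    using assms(1,3) by (simp add: AE_restrict_space_iff)
  then have "AE x in lebesgue. x \<in> ?F -` A \<longleftrightarrow> x \<in> ?G -` A"
    by eventually_elim auto
  then have "?G -` A \<in> sets lebesgue"
    using F by (rule completion.in_sets_AE) simp
  then show "?G -` A \<inter> space lebesgue \<in> sets lebesgue"
    by simp
qed simp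

lemma Linf_norm_AE_cong:
  assumes "S \<in> sets lebesgue" "f \<in> borel_measurable (lebesgue_on S)"
    and "AE x in lebesgue_on S. f x = g x"
  shows "Linf_norm S f = Linf_norm S g"
proof -
  have g: "g \<in> borel_measurable (lebesgue_on S)"
    using assms by (rule borel_measurable_lebesgue_on_AE_cong)
  show ?thesis
    unfolding Linf_norm_def
  proof (rule esssup_AE_cong)
    show "AE x in lebesgue_on S. ereal (norm (f x)) = ereal (norm (g x))"
      using assms(3) by eventually_elim simp
  qed (use assms(2) g in measurable)
qed

lemma Linf_norm_weak_gradient:
  assumes "open \<Omega>" "is_weak_gradient \<Omega> v g" "g \<in> borel_measurable (lebesgue_on \<Omega>)"
  shows "Linf_norm \<Omega> (weak_gradient \<Omega> v) = Linf_norm \<Omega> g"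
proof -
  have "is_weak_gradient \<Omega> v (weak_gradient \<Omega> v)"
    unfolding weak_gradient_def using someI[of "is_weak_gradient \<Omega> v", OF assms(2)] .
  from weak_gradient_unique[OF assms(1,2) this] assms(1,3) show ?thesis
    by (intro Linf_norm_AE_cong[symmetric]) auto
qed

lemma Linf_norm_scaleR:
  assumes "c > 0"
  shows "Linf_norm \<Omega> (\<lambda>x. c *\<^sub>R f x) = ereal c * Linf_norm \<Omega> f"
  unfolding Linf_norm_def
  using assms esssup_cmult[OF assms, of "lebesgue_on \<Omega>" "\<lambda>x. ereal (norm (f x))"]
  by simp

lemma is_weak_gradient_scaleR:
  assumes "is_weak_gradient \<Omega> v g"
  shows "is_weak_gradient \<Omega> (\<lambda>x. c * v x) (\<lambda>x. c *\<^sub>R g x)"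
proof -
  have "(LINT x|lebesgue_on \<Omega>. c * v x * frechet_derivative \<phi> (at x) i) =
        - (LINT x|lebesgue_on \<Omega>. (c *\<^sub>R g x \<bullet> i) * \<phi> x)"
    if "\<phi> \<in> test_functions \<Omega>" "i \<in> Basis" for \<phi> i
    using assms that by (simp add: is_weak_gradient_def mult.assoc)
  moreover have "(\<lambda>x. c * v x) absolutely_integrable_on K" "(\<lambda>x. c *\<^sub>R g x) absolutely_integrable_on K"
    if "compact K" "K \<subseteq> \<Omega>" for K
    using assms that by (auto simp: is_weak_gradient_def intro: absolutely_integrable_scaleR_left)
  ultimately show ?thesis
    by (auto simp: is_weak_gradient_def)
qed

lemma W1inf_weak_gradient_finite:
  assumes "open \<Omega>" "v \<in> W1inf \<Omega>"
  shows "Linf_norm \<Omega> (weak_gradient \<Omega> v) < \<infinity>"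
  using assms Linf_norm_weak_gradient[OF assms(1)] by (auto simp: W1inf_def Linf_def)

lemma Linf_scaleR:
  assumes f: "f \<in> Linf \<Omega>" and c: "c > 0"
  shows "(\<lambda>x. c *\<^sub>R f x) \<in> Linf \<Omega>"
proof -
  have "ereal c * Linf_norm \<Omega> f < \<infinity>"
    using f c by (cases "Linf_norm \<Omega> f") (auto simp: Linf_def)
  with f show ?thesis
    by (auto simp: Linf_def Linf_norm_scaleR[OF c])
qed

lemma W1inf_scale:
  assumes "open \<Omega>" "v \<in> W1inf \<Omega>" "c > 0"
  shows "(\<lambda>x. c * v x) \<in> W1inf \<Omega>"
    and "Linf_norm \<Omega> (weak_gradient \<Omega> (\<lambda>x. c * v x)) = ereal c * Linf_norm \<Omega> (weak_gradient \<Omega> v)"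
proof -
  obtain g where v: "v \<in> Linf \<Omega>" and g: "g \<in> Linf \<Omega>" and wg: "is_weak_gradient \<Omega> v g"
    using assms(2) by (auto simp: W1inf_def)
  note wg' = is_weak_gradient_scaleR[OF wg, of c]
  show "(\<lambda>x. c * v x) \<in> W1inf \<Omega>"
    using Linf_scaleR[OF v assms(3)] Linf_scaleR[OF g assms(3)] wg' by (auto simp: W1inf_def)
  show "Linf_norm \<Omega> (weak_gradient \<Omega> (\<lambda>x. c * v x)) = ereal c * Linf_norm \<Omega> (weak_gradient \<Omega> v)"
    using Linf_norm_weak_gradient[OF assms(1) wg'] Linf_norm_weak_gradient[OF assms(1) wg]
      Linf_scaleR[OF g assms(3)] g
    by (simp add: Linf_norm_scaleR[OF assms(3)] Linf_def)
qed

section \<open>A competitor with positive objective value\<close>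

lemma has_real_derivative_max0_square:
  "((\<lambda>t::real. (max 0 t)\<^sup>2) has_real_derivative 2 * max 0 t) (at t)"
proof (cases t "0 :: real" rule: linorder_cases)
  case less
  have "((\<lambda>_. 0) has_real_derivative 2 * max 0 t) (at t)" using less by simp
  then show ?thesis
    by (rule has_field_derivative_transform_within_open[of _ _ _ "{..<0}"]) (use less in auto)
next
  case equal
  have "((\<lambda>h::real. max 0 h) \<longlongrightarrow> max 0 0) (at 0)"
    by (intro tendsto_intros)
  then have "((\<lambda>h::real. max 0 h) \<longlongrightarrow> 0) (at 0)"
    by simp
  then have "((\<lambda>h::real. (max 0 h)\<^sup>2 / h) \<longlongrightarrow> 0) (at 0)"
    by (rule Lim_transform_eventually)
      (auto simp: max_def power2_eq_square intro: always_eventually)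
  then show ?thesis
    using equal by (simp add: has_field_derivative_iff)
next
  case greater
  have "((\<lambda>t. t\<^sup>2) has_real_derivative 2 * max 0 t) (at t)"
    using greater by (auto intro!: derivative_eq_intros)
  then show ?thesis
    by (rule has_field_derivative_transform_within_open[of _ _ _ "{0<..}"]) (use greater in auto)
qed

text \<open>
  The square makes the positive part of \<open>r\<^sup>2 - |x - z|\<^sup>2\<close> continuously differentiable across the sphere.
\<close>

definition ball_bump :: "'a::euclidean_space \<Rightarrow> real \<Rightarrow> 'a \<Rightarrow> real" where
  "ball_bump z r x = (max 0 (r\<^sup>2 - (x - z) \<bullet> (x - z)))\<^sup>2"

definition ball_bump_gradient :: "'a::euclidean_space \<Rightarrow> real \<Rightarrow> 'a \<Rightarrow> 'a" where
  "ball_bump_gradient z r x = (- 4 * max 0 (r\<^sup>2 - (x - z) \<bullet> (x - z))) *\<^sub>R (x - z)"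

lemma has_derivative_ball_bump:
  "(ball_bump z r has_derivative (\<lambda>h. ball_bump_gradient z r x \<bullet> h)) (at x)"
proof -
  have "((\<lambda>x. r\<^sup>2 - (x - z) \<bullet> (x - z)) has_derivative (\<lambda>h. - 2 * ((x - z) \<bullet> h))) (at x)"
    by (auto intro!: derivative_eq_intros simp: inner_commute)
  from has_derivative_compose[OF this
      has_real_derivative_max0_square[unfolded has_field_derivative_def]]
  show ?thesis
    unfolding ball_bump_def[abs_def] ball_bump_gradient_def by (simp add: mult_ac)
qed

lemma continuous_on_ball_bump: "continuous_on S (ball_bump z r)"
  and continuous_on_ball_bump_gradient: "continuous_on S (ball_bump_gradient z r)"
  unfolding ball_bump_def[abs_def] ball_bump_gradient_def[abs_def] by (intro continuous_intros)+

lemma ball_bump_nonneg: "0 \<le> ball_bump z r x"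
  by (simp add: ball_bump_def)

lemma ball_bump_eq_0_iff:
  assumes "r > 0"
  shows "ball_bump z r x = 0 \<longleftrightarrow> x \<notin> ball z r"
proof -
  have "(dist z x)\<^sup>2 = (x - z) \<bullet> (x - z)"
    by (metis dist_commute dist_norm power2_norm_eq_inner)
  moreover have "dist z x < r \<longleftrightarrow> (dist z x)\<^sup>2 < r\<^sup>2"
    using assms by (metis power2_less_imp_less power_strict_mono less_imp_le pos2 zero_le_dist)
  ultimately show ?thesis
    by (auto simp: ball_bump_def max_def not_less)
qed

text \<open>
  The integrand is nonnegative because \<open>b\<close> vanishes wherever \<open>a\<close> may be negative, and it is positive on
  a nonempty open set, which is not a null set.
\<close>

lemma integral_weighted_bump_pos:
  fixes a b :: "'a::euclidean_space \<Rightarrow> real"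
  assumes "open \<Omega>" "bounded \<Omega>" and a: "a \<in> Linf \<Omega>"
    and b: "continuous_on UNIV b" "\<And>x. 0 \<le> b x" and B: "open B" "B \<noteq> {}" "B \<subseteq> {x \<in> \<Omega>. a x > 0}"
    and bB: "\<And>x. b x = 0 \<longleftrightarrow> x \<notin> B" and "q > 0"
  shows "integrable (lebesgue_on \<Omega>) (\<lambda>x. a x * b x powr q)"
    and "0 < (LINT x|lebesgue_on \<Omega>. a x * b x powr q)"
proof -
  have \<Omega>: "\<Omega> \<in> sets lebesgue" using assms(1) by simp
  have bq: "continuous_on UNIV (\<lambda>x. b x powr q)"
    using b assms(10) by (intro continuous_on_powr') auto
  have "compact ((\<lambda>x. b x powr q) ` closure \<Omega>)"
    using assms(2) bq by (intro compact_continuous_image) (auto intro: continuous_on_subset)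
  then obtain C where "\<And>x. x \<in> closure \<Omega> \<Longrightarrow> norm (b x powr q) \<le> C"
    using compact_imp_bounded[of "(\<lambda>x. b x powr q) ` closure \<Omega>"] by (auto simp: bounded_iff)
  then have C: "b x powr q \<le> \<bar>C\<bar>" if "x \<in> \<Omega>" for x
    using that closure_subset[of \<Omega>] by force
  have am: "a \<in> borel_measurable (lebesgue_on \<Omega>)" and an: "Linf_norm \<Omega> a < \<infinity>"
    using a by (auto simp: Linf_def)
  have bm: "(\<lambda>x. b x powr q) \<in> borel_measurable (lebesgue_on \<Omega>)"
    by (rule continuous_imp_measurable_on_sets_lebesgue[OF continuous_on_subset[OF bq] \<Omega>]) simp
  obtain A where "Linf_norm \<Omega> a \<le> ereal A"
    using an by (cases "Linf_norm \<Omega> a") auto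
  moreover have "AE x in lebesgue_on \<Omega>. ereal (norm (a x)) \<le> Linf_norm \<Omega> a"
    unfolding Linf_norm_def by (rule esssup_AE)
  ultimately have A: "AE x in lebesgue_on \<Omega>. \<bar>a x\<bar> \<le> A"
    by (auto elim!: eventually_mono dest: order_trans)
  show int: "integrable (lebesgue_on \<Omega>) (\<lambda>x. a x * b x powr q)"
  proof (rule integrableI_bounded_set[where A = \<Omega> and B = "A * \<bar>C\<bar>"])
    have "emeasure lebesgue \<Omega> < \<infinity>"
      using bounded_set_imp_lmeasurable[OF assms(2) \<Omega>] by (metis fmeasurableD2 infinity_ennreal_def less_top)
    then show "emeasure (lebesgue_on \<Omega>) \<Omega> < \<infinity>"
      using \<Omega> by (simp add: emeasure_restrict_space)
    have "AE x in lebesgue_on \<Omega>. x \<in> \<Omega>"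
      using AE_space[of "lebesgue_on \<Omega>"] by simp
    with A show "AE x in lebesgue_on \<Omega>. x \<in> \<Omega> \<longrightarrow> norm (a x * b x powr q) \<le> A * \<bar>C\<bar>"
      by eventually_elim (auto simp: abs_mult intro!: mult_mono C)
    show "\<Omega> \<in> sets (lebesgue_on \<Omega>)"
      using \<Omega> by (simp add: sets_restrict_space_iff)
    show "(\<lambda>x. a x * b x powr q) \<in> borel_measurable (lebesgue_on \<Omega>)"
      using am bm by (rule borel_measurable_times)
    show "AE x in lebesgue_on \<Omega>. x \<notin> \<Omega> \<longrightarrow> a x * b x powr q = 0"
      using \<open>AE x in lebesgue_on \<Omega>. x \<in> \<Omega>\<close> by eventually_elim simp
  qed
  have nonneg: "0 \<le> a x * b x powr q" for x
    using B(3) bB[of x] by (cases "x \<in> B") (auto intro: less_imp_le)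
  have "(LINT x|lebesgue_on \<Omega>. a x * b x powr q) \<noteq> 0"
  proof
    assume "(LINT x|lebesgue_on \<Omega>. a x * b x powr q) = 0"
    then have "AE x in lebesgue_on \<Omega>. a x * b x powr q = 0"
      using integral_nonneg_eq_0_iff_AE[OF int] nonneg by simp
    then have "AE x in lebesgue. x \<in> \<Omega> \<longrightarrow> a x * b x powr q = 0"
      using \<Omega> by (simp add: AE_restrict_space_iff)
    then have "AE x in lebesgue. x \<notin> B"
      by eventually_elim (use B(3) bB in fastforce)
    then have "negligible B"
      using B(1) by (simp add: negligible_iff_null_sets AE_iff_null_sets)
    then show False
      using open_not_negligible B(1,2) by blast
  qed
  moreover have "0 \<le> (LINT x|lebesgue_on \<Omega>. a x * b x powr q)"
    using nonneg by simp
  ultimately show "0 < (LINT x|lebesgue_on \<Omega>. a x * b x powr q)"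
    by simp
qed

lemma disjoint_balls_in_open_set:
  fixes U :: "'a::euclidean_space set"
  assumes "open U" "U \<noteq> {}"
  obtains y z r where "r > 0" "ball y r \<subseteq> U" "ball z r \<subseteq> U" "ball y r \<inter> ball z r = {}"
proof -
  obtain c \<rho> where \<rho>: "\<rho> > 0" "ball c \<rho> \<subseteq> U"
    using assms open_contains_ball by blast
  obtain e :: 'a where e: "norm e = 1"
    using vector_choose_size[of 1] by auto
  define y z where "y = c - (\<rho>/2) *\<^sub>R e" and "z = c + (\<rho>/2) *\<^sub>R e"
  have dc: "dist c y = \<rho>/2" "dist c z = \<rho>/2"
    using e \<rho>(1) by (auto simp: y_def z_def dist_norm)
  have half: "ball w (\<rho>/2) \<subseteq> ball c \<rho>" if "dist c w = \<rho>/2" for w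
    using dist_triangle_lt[of c w _ \<rho>] that by (force simp: dist_commute)
  have "y - z = (- \<rho>) *\<^sub>R e"
    by (simp add: y_def z_def algebra_simps flip: scaleR_add_left)
  then have "dist y z = \<rho>"
    using e \<rho>(1) by (simp add: dist_norm)
  then have "ball y (\<rho>/2) \<inter> ball z (\<rho>/2) = {}"
    by (intro disjoint_ballI) simp
  then show ?thesis
    using that[of "\<rho>/2" y z] \<rho> half[OF dc(1)] half[OF dc(2)] by auto
qed

text \<open>
  With disjointly supported bumps, \<open>|v| powr p\<close> and \<open>|v| powr (p - 2) v\<close> have no mixed terms, so the
  weight \<open>s\<close> of the negative bump can be adjusted to meet the constraint.
\<close>

lemma exists_balanced_positive_W1inf:
  fixes a :: "'a::euclidean_space \<Rightarrow> real"
  assumes "open \<Omega>" "bounded \<Omega>" "a \<in> Linf \<Omega>" "interior {x \<in> \<Omega>. a x > 0} \<noteq> {}" "p > 1"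
  obtains v where "v \<in> W1inf \<Omega>"
    "(LINT x|lebesgue_on \<Omega>. a x * (\<bar>v x\<bar> powr (p - 2) * v x)) = 0"
    "0 < (LINT x|lebesgue_on \<Omega>. a x * \<bar>v x\<bar> powr p)"
proof -
  obtain y z r where r: "r > 0" "ball y r \<subseteq> interior {x \<in> \<Omega>. a x > 0}"
    "ball z r \<subseteq> interior {x \<in> \<Omega>. a x > 0}" "ball y r \<inter> ball z r = {}"
    by (rule disjoint_balls_in_open_set[OF open_interior assms(4)])
  have *: "integrable (lebesgue_on \<Omega>) (\<lambda>x. a x * ball_bump c r x powr q)"
    "0 < (LINT x|lebesgue_on \<Omega>. a x * ball_bump c r x powr q)" if "c \<in> {y, z}" "q > 0" for c q
  proof -
    have "ball c r \<subseteq> {x \<in> \<Omega>. a x > 0}"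
      using that(1) r(2,3) interior_subset by blast
    moreover have "ball c r \<noteq> {}" using r(1) by simp
    ultimately show "integrable (lebesgue_on \<Omega>) (\<lambda>x. a x * ball_bump c r x powr q)"
      "0 < (LINT x|lebesgue_on \<Omega>. a x * ball_bump c r x powr q)"
      using integral_weighted_bump_pos[OF assms(1-3) continuous_on_ball_bump ball_bump_nonneg
          open_ball _ _ ball_bump_eq_0_iff[OF r(1)] that(2)] by blast+
  qed
  define I where "I q c = (LINT x|lebesgue_on \<Omega>. a x * ball_bump c r x powr q)" for q c
  have I: "0 < I (p - 1) y" "0 < I (p - 1) z" "0 < I p y" "0 < I p z"
    using * assms(5) by (auto simp: I_def)
  define s where "s = (I (p - 1) y / I (p - 1) z) powr (1 / (p - 1))"
  have s: "s > 0" "s powr (p - 1) = I (p - 1) y / I (p - 1) z"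
    using I assms(5) by (auto simp: s_def powr_powr)
  define v where "v x = ball_bump y r x - s * ball_bump z r x" for x
  have split: "\<bar>v x\<bar> powr p = ball_bump y r x powr p + s powr p * ball_bump z r x powr p"
    "\<bar>v x\<bar> powr (p - 2) * v x =
      ball_bump y r x powr (p - 1) - s powr (p - 1) * ball_bump z r x powr (p - 1)" for x
  proof -
    have mult: "t powr (p - 2) * t = t powr (p - 1)" if "t \<ge> 0" for t
      using that powr_add[of t "p - 2" 1] by (cases "t = 0") auto
    have b: "0 \<le> ball_bump y r x" "0 \<le> ball_bump z r x"
      by (rule ball_bump_nonneg)+
    have "ball_bump y r x = 0 \<or> ball_bump z r x = 0"
      using r(1,4) by (auto simp: ball_bump_eq_0_iff)
    then show "\<bar>v x\<bar> powr p = ball_bump y r x powr p + s powr p * ball_bump z r x powr p"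
      "\<bar>v x\<bar> powr (p - 2) * v x =
        ball_bump y r x powr (p - 1) - s powr (p - 1) * ball_bump z r x powr (p - 1)"
      using b s(1) mult[of "ball_bump y r x"] mult[of "s * ball_bump z r x"]
      by (auto simp: v_def powr_mult)
  qed
  show thesis
  proof
    show "v \<in> W1inf \<Omega>"
    proof (rule C1_in_W1inf[OF assms(1,2)])
      show "(v has_derivative (\<lambda>h. (ball_bump_gradient y r x - s *\<^sub>R ball_bump_gradient z r x) \<bullet> h)) (at x)" for x
        unfolding v_def[abs_def] inner_diff_left inner_scaleR_left
        by (intro has_derivative_diff has_derivative_mult_right has_derivative_ball_bump)
    qed (intro continuous_intros continuous_on_ball_bump_gradient)
    have "(LINT x|lebesgue_on \<Omega>. a x * (\<bar>v x\<bar> powr (p - 2) * v x)) =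
        I (p - 1) y - s powr (p - 1) * I (p - 1) z"
      using *[of _ "p - 1"] assms(5) by (simp add: split I_def right_diff_distrib mult.left_commute[of "a _"])
    then show "(LINT x|lebesgue_on \<Omega>. a x * (\<bar>v x\<bar> powr (p - 2) * v x)) = 0"
      using I s(2) by simp
    have "(LINT x|lebesgue_on \<Omega>. a x * \<bar>v x\<bar> powr p) = I p y + s powr p * I p z"
      using *[of _ p] assms(5) by (simp add: split I_def distrib_left mult.left_commute[of "a _"])
    then show "0 < (LINT x|lebesgue_on \<Omega>. a x * \<bar>v x\<bar> powr p)"
      using I s(1) by (simp add: add_pos_pos)
  qed
qed

section \<open>The constraint on the gradient is active at a maximizer\<close>

lemma integral_scaled_powr:
  fixes a v :: "'a::euclidean_space \<Rightarrow> real"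
  assumes "c > 0"
  shows "(LINT x|M. a x * \<bar>c * v x\<bar> powr p) = c powr p * (LINT x|M. a x * \<bar>v x\<bar> powr p)"
    and "(LINT x|M. a x * (\<bar>c * v x\<bar> powr q * (c * v x))) =
      c powr (q + 1) * (LINT x|M. a x * (\<bar>v x\<bar> powr q * v x))"
proof -
  have 1: "a x * \<bar>c * v x\<bar> powr p = c powr p * (a x * \<bar>v x\<bar> powr p)"
    and 2: "a x * (\<bar>c * v x\<bar> powr q * (c * v x)) = c powr (q + 1) * (a x * (\<bar>v x\<bar> powr q * v x))" for x
    using assms by (simp_all add: abs_mult powr_mult powr_add)
  show "(LINT x|M. a x * \<bar>c * v x\<bar> powr p) = c powr p * (LINT x|M. a x * \<bar>v x\<bar> powr p)"
    unfolding 1 by simp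
  show "(LINT x|M. a x * (\<bar>c * v x\<bar> powr q * (c * v x))) =
      c powr (q + 1) * (LINT x|M. a x * (\<bar>v x\<bar> powr q * v x))"
    unfolding 2 by simp
qed

theorem lemma4p5:
  fixes \<Omega> :: "(real ^ 'n) set" and a u :: "real ^ 'n \<Rightarrow> real" and p :: real
  assumes "CARD('n) \<ge> 2"
    and "open \<Omega>" "connected \<Omega>" "\<Omega> \<noteq> {}" "bounded \<Omega>" "convex \<Omega>" "C2_boundary \<Omega>"
    and "a \<in> Linf \<Omega>" "(LINT x|lebesgue_on \<Omega>. a x) < 0"
    and "interior {x \<in> \<Omega>. a x > 0} \<noteq> {}"
    and "p > 2"
    and "is_arg_max (\<lambda>v. LINT x|lebesgue_on \<Omega>. a x * \<bar>v x\<bar> powr p)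
           (\<lambda>v. v \<in> W1inf \<Omega> \<and>
                (LINT x|lebesgue_on \<Omega>. a x * (\<bar>v x\<bar> powr (p - 2) * v x)) = 0 \<and>
                Linf_norm \<Omega> (weak_gradient \<Omega> v) \<le> 1) u"
  shows "Linf_norm \<Omega> (weak_gradient \<Omega> u) = 1"
proof (rule ccontr)
  let ?J = "\<lambda>v. LINT x|lebesgue_on \<Omega>. a x * \<bar>v x\<bar> powr p"
  let ?balanced = "\<lambda>v. v \<in> W1inf \<Omega> \<and> (LINT x|lebesgue_on \<Omega>. a x * (\<bar>v x\<bar> powr (p - 2) * v x)) = 0"
  let ?N = "\<lambda>v. Linf_norm \<Omega> (weak_gradient \<Omega> v)"
  have u: "?balanced u" "?N u \<le> 1" and max: "\<And>v. ?balanced v \<Longrightarrow> ?N v \<le> 1 \<Longrightarrow> ?J v \<le> ?J u"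
    using assms(12) by (auto simp: is_arg_max_linorder)
  (* Every balanced v becomes admissible after division by a bound K of its gradient. With K \<ge> 1 this
     bounds the maximum from below by a positive number; with v = u and K < 1 it contradicts maximality. *)
  have bound: "(1 / K) powr p * ?J v \<le> ?J u" if v: "?balanced v" and K: "?N v \<le> ereal K" "K > 0" for v K
  proof -
    have "ereal (1 / K) * ?N v \<le> ereal (1 / K) * ereal K"
      using K by (intro ereal_mult_left_mono) auto
    then have "?N (\<lambda>x. (1 / K) * v x) \<le> 1"
      using W1inf_scale(2)[OF assms(2), of v "1 / K"] v K(2) by (simp add: one_ereal_def)
    moreover have "?balanced (\<lambda>x. (1 / K) * v x)"
      using W1inf_scale(1)[OF assms(2), of v "1 / K"] v K(2)
        integral_scaled_powr(2)[of "1 / K" "lebesgue_on \<Omega>" a v "p - 2"] by simp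
    ultimately have "?J (\<lambda>x. (1 / K) * v x) \<le> ?J u"
      by (intro max)
    then show ?thesis
      using integral_scaled_powr(1)[of "1 / K" "lebesgue_on \<Omega>" a v p] K(2) by simp
  qed
  have "?J u > 0"
  proof -
    obtain v where v: "?balanced v" "0 < ?J v"
      using exists_balanced_positive_W1inf[OF assms(2,5,8,10), of p] assms(11) by auto
    have "?N v < \<infinity>"
      using W1inf_weak_gradient_finite[OF assms(2)] v(1) by blast
    then obtain k where "?N v \<le> ereal k"
      by (cases "?N v") auto
    then have "?N v \<le> ereal (max 1 k)"
      by (rule order_trans) simp
    from bound[OF v(1) this] v(2) show ?thesis
      by (smt (verit) mult_pos_pos powr_gt_zero zero_less_divide_1_iff)
  qed
  assume "?N u \<noteq> 1"
  then have "?N u < 1" using u(2) by simp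
  then obtain t where t: "?N u < ereal t" "ereal t < 1"
    using ereal_dense2 by blast
  (* The maximum with 1/2 keeps K positive when t is not. *)
  define K where "K = max (1 / 2) t"
  have K: "?N u \<le> ereal K" "0 < K" "K < 1"
    using t by (auto simp: K_def max_def one_ereal_def intro: less_imp_le order_trans[of _ "ereal t"])
  have "1 < (1 / K) powr p"
    using K assms(11) by (intro gr_one_powr) auto
  then have "?J u < (1 / K) powr p * ?J u"
    using \<open>?J u > 0\<close> by simp
  with bound[OF u(1) K(1,2)] show False by simp
qed

end
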